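(* Let $\mathcal{H}$ be a real Hilbert space, let $V:\mathcal{H}\to\mathcal{H}$ be monotone and continuous, and let $x_*\in\mathcal{H}$ with $V(x_* )=0$. Let $\alpha>2$, $s_0>0$, $x_0,x_1\in\mathcal{H}$, and let $x:[s_0,+\infty)\to\mathcal{H}$ be a solution of $$\begin{cases}\ddot x(s)+\frac{\alpha}{s}\dot x(s)+\frac{d}{ds}V(x(s))+\frac{\alpha}{2s}V(x(s))=0,\\ x(s_0)=x_0,\quad\dot x(s_0)=x_1.\end{cases}$$ Then, as $s\to+\infty$, $$\|V(x(s))\|=o\left(\frac1s\right),\qquad\langle x(s)-x_*,V(x(s))\rangle=o\left(\frac1s\right),\qquad\|\dot x(s)\|=o\left(\frac1s\right).$$ Furthermore, $x(s)$ converges weakly to a zero of $V$ as $s\to+\infty$.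
   Context: $V$ is monotone if $\langle V(y)-V(x),y-x\rangle\ge0$ for all $x,y\in\mathcal{H}$. A zero of $V$ is a point $z\in\mathcal{H}$ with $V(z)=0$. A solution is a function $x:[s_0,+\infty)\to\mathcal{H}$ such that $x$, $\dot x$ and $s\mapsto V(x(s))$ are absolutely continuous on each interval $[s_0,s_1]$, the equation holds for almost every $s\ge s_0$, and the initial conditions hold. *)

theory Defs
  imports "HOL-Analysis.Analysis" "HOL-Library.Landau_Symbols"
begin

definition monotone_operator :: "('a::real_inner \<Rightarrow> 'a) \<Rightarrow> bool" where
  "monotone_operator V \<longleftrightarrow> (\<forall>x y. 0 \<le> (V y - V x) \<bullet> (y - x))"

definition abs_continuous_on_interval ::
    "real \<Rightarrow> real \<Rightarrow> (real \<Rightarrow> 'a::real_normed_vector) \<Rightarrow> bool" where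
  "abs_continuous_on_interval a b f \<longleftrightarrow>
    (\<forall>\<epsilon>>0. \<exists>\<delta>>0. \<forall>(n::nat) u v.
      (\<forall>i<n. a \<le> u i \<and> u i \<le> v i \<and> v i \<le> b) \<longrightarrow>
      disjoint_family_on (\<lambda>i. {u i <..< v i}) {..<n} \<longrightarrow>
      (\<Sum>i<n. v i - u i) < \<delta> \<longrightarrow>
      (\<Sum>i<n. norm (f (v i) - f (u i))) < \<epsilon>)"

text \<open>
  The first derivative of a trajectory on \<open>[s0, \<infinity>)\<close>; at the left end point it is the right
  derivative, and values of \<open>x\<close> to the left of \<open>s0\<close> play no role.
\<close>

definition velocity :: "real \<Rightarrow> (real \<Rightarrow> 'a::real_normed_vector) \<Rightarrow> real \<Rightarrow> 'a" where
  "velocity s0 x s = vector_derivative x (at s within {s0..})"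

text \<open>
  Requiring \<open>velocity s0 x\<close> to be absolutely continuous only makes sense if \<open>x\<close> has a derivative
  at every point (not just almost everywhere), so this is demanded explicitly; it also
  gives \<open>velocity s0 x s0 = x1\<close> its meaning. The derivatives \<open>a\<close> of the velocity and \<open>b\<close> of
  \<open>V (x s)\<close> are only required to exist almost everywhere.
\<close>

definition is_solution ::
    "('a::real_inner \<Rightarrow> 'a) \<Rightarrow> real \<Rightarrow> real \<Rightarrow> 'a \<Rightarrow> 'a \<Rightarrow> (real \<Rightarrow> 'a) \<Rightarrow> bool" where
  "is_solution V \<alpha> s0 x0 x1 x \<longleftrightarrow>
    (\<forall>s\<ge>s0. x differentiable (at s within {s0..})) \<and>
    (\<forall>s1\<ge>s0. abs_continuous_on_interval s0 s1 x \<and>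
             abs_continuous_on_interval s0 s1 (velocity s0 x) \<and>
             abs_continuous_on_interval s0 s1 (\<lambda>s. V (x s))) \<and>
    (AE s in lebesgue. s \<ge> s0 \<longrightarrow>
      (\<exists>a b. (velocity s0 x has_vector_derivative a) (at s within {s0..}) \<and>
             ((\<lambda>t. V (x t)) has_vector_derivative b) (at s within {s0..}) \<and>
             a + (\<alpha> / s) *\<^sub>R velocity s0 x s + b + (\<alpha> / (2 * s)) *\<^sub>R V (x s) = 0)) \<and>
    x s0 = x0 \<and> velocity s0 x s0 = x1"

definition converges_weakly :: "('b \<Rightarrow> 'a::real_inner) \<Rightarrow> 'a \<Rightarrow> 'b filter \<Rightarrow> bool" where
  "converges_weakly x z F \<longleftrightarrow> (\<forall>y. ((\<lambda>s. x s \<bullet> y) \<longlongrightarrow> z \<bullet> y) F)"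

end

theory Submission
  imports Defs
begin

text \<open>
  With \<open>z = x - x\<^sub>*\<close>, \<open>v\<close> the velocity and \<open>w = V (x s)\<close>, consider
  \<open>E \<mu> = \<parallel>2 \<mu> z + s (2 v + w)\<parallel>\<^sup>2 / 2 + 2 \<mu> (\<alpha> - 1 - \<mu>) \<parallel>z\<parallel>\<^sup>2 + 2 \<mu> s (z \<bullet> w) + s\<^sup>2 \<parallel>w\<parallel>\<^sup>2 / 2\<close>.
  It is nonnegative and nonincreasing for \<open>1 \<le> \<mu> \<le> \<alpha> - 1\<close>, hence convergent, and it is affine in \<open>\<mu>\<close>.
  Convergence for the two values \<open>\<mu> = 1\<close> and \<open>\<mu> = \<alpha> / 2\<close> therefore gives convergence of \<open>E 0\<close> and of the
  slope. For \<open>\<mu> = \<alpha> / 2\<close> the decay rate is at least \<open>(\<alpha> - 2) E 0 / s\<close>; as \<open>1 / s\<close> is not integrable,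
  \<open>E 0\<close> tends to \<open>0\<close>, and this controls \<open>s \<parallel>v\<parallel>\<close> and \<open>s \<parallel>w\<parallel>\<close>. The slope then shows that \<open>\<parallel>x - z\<^sub>0\<parallel>\<close>
  converges for every zero \<open>z\<^sub>0\<close> of \<open>V\<close>, and Opial's argument together with Minty's trick yields weak
  convergence.
\<close>

subsection \<open>Absolutely continuous functions\<close>

lemma abs_continuous_on_intervalE:
  assumes "abs_continuous_on_interval a b f" "e > 0"
  obtains d where "d > 0"
    "\<forall>(n::nat) u v. (\<forall>i<n. a \<le> u i \<and> u i \<le> v i \<and> v i \<le> b) \<longrightarrow>
      disjoint_family_on (\<lambda>i. {u i <..< v i}) {..<n} \<longrightarrow>
      (\<Sum>i<n. v i - u i) < d \<longrightarrow> (\<Sum>i<n. norm (f (v i) - f (u i))) < e"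
  using assms(1)[unfolded abs_continuous_on_interval_def, rule_format, OF assms(2)]
  by (elim exE conjE)

text \<open>A bijection with \<open>{..<card I}\<close> reindexes the sums. With arbitrary finite
  index sets, the pieces of a tagged division can serve directly as indices.\<close>

lemma abs_continuous_on_intervalD_finite:
  assumes "abs_continuous_on_interval a b f" "e > 0"
  obtains d where "d > 0"
    "\<forall>I (u :: 'i \<Rightarrow> real) v. finite I \<longrightarrow> (\<forall>i\<in>I. a \<le> u i \<and> u i \<le> v i \<and> v i \<le> b) \<longrightarrow>
      disjoint_family_on (\<lambda>i. {u i<..<v i}) I \<longrightarrow> (\<Sum>i\<in>I. v i - u i) < d \<longrightarrow>
      (\<Sum>i\<in>I. norm (f (v i) - f (u i))) < e"
proof -
  obtain d where "d > 0" and d: "\<forall>(n::nat) u v. (\<forall>i<n. a \<le> u i \<and> u i \<le> v i \<and> v i \<le> b) \<longrightarrow>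
      disjoint_family_on (\<lambda>i. {u i <..< v i}) {..<n} \<longrightarrow>
      (\<Sum>i<n. v i - u i) < d \<longrightarrow>
      (\<Sum>i<n. norm (f (v i) - f (u i))) < e"
    by (rule abs_continuous_on_intervalE[OF assms], erule that)
  show thesis
  proof (rule that[OF \<open>d > 0\<close>], intro allI impI)
    fix I and u v :: "'i \<Rightarrow> real"
    assume I: "finite I" "\<forall>i\<in>I. a \<le> u i \<and> u i \<le> v i \<and> v i \<le> b"
      "disjoint_family_on (\<lambda>i. {u i<..<v i}) I" "(\<Sum>i\<in>I. v i - u i) < d"
    obtain h where "bij_betw h {0..<card I} I"
      using ex_bij_betw_nat_finite[OF I(1)] by blast
    then have h: "bij_betw h {..<card I} I"
      by (simp add: atLeast0LessThan)
    have mem: "h i \<in> I" if "i < card I" for i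
      using h that by (auto simp: bij_betw_def)
    have "disjoint_family_on (\<lambda>i. {u (h i) <..< v (h i)}) {..<card I}"
      unfolding disjoint_family_on_def
    proof (intro ballI impI)
      fix i j assume "i \<in> {..<card I}" "j \<in> {..<card I}" "i \<noteq> j"
      then have "h i \<noteq> h j" "h i \<in> I" "h j \<in> I"
        using h mem by (auto simp: bij_betw_def inj_on_def)
      then show "{u (h i)<..<v (h i)} \<inter> {u (h j)<..<v (h j)} = {}"
        using I(3) unfolding disjoint_family_on_def by blast
    qed
    moreover have "\<forall>i<card I. a \<le> u (h i) \<and> u (h i) \<le> v (h i) \<and> v (h i) \<le> b"
      using I(2) mem by blast
    moreover have "(\<Sum>i<card I. v (h i) - u (h i)) < d"
      using I(4) by (simp add: sum.reindex_bij_betw[OF h, of "\<lambda>i. v i - u i"])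
    ultimately have "(\<Sum>i<card I. norm (f (v (h i)) - f (u (h i)))) < e"
      using d by simp
    then show "(\<Sum>i\<in>I. norm (f (v i) - f (u i))) < e"
      using sum.reindex_bij_betw[OF h, of "\<lambda>i. norm (f (v i) - f (u i))"] by simp
  qed
qed

lemma abs_continuous_on_interval_subset:
  assumes "abs_continuous_on_interval a b f" "a \<le> a'" "b' \<le> b"
  shows "abs_continuous_on_interval a' b' f"
  unfolding abs_continuous_on_interval_def
proof (intro allI impI)
  fix e :: real assume "e > 0"
  obtain d where "d > 0" and d: "\<forall>(n::nat) u v. (\<forall>i<n. a \<le> u i \<and> u i \<le> v i \<and> v i \<le> b) \<longrightarrow>
      disjoint_family_on (\<lambda>i. {u i <..< v i}) {..<n} \<longrightarrow>
      (\<Sum>i<n. v i - u i) < d \<longrightarrow>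
      (\<Sum>i<n. norm (f (v i) - f (u i))) < e"
    by (rule abs_continuous_on_intervalE[OF assms(1) \<open>e > 0\<close>], erule that)
  show "\<exists>d>0. \<forall>(n::nat) u v. (\<forall>i<n. a' \<le> u i \<and> u i \<le> v i \<and> v i \<le> b') \<longrightarrow>
      disjoint_family_on (\<lambda>i. {u i <..< v i}) {..<n} \<longrightarrow>
      (\<Sum>i<n. v i - u i) < d \<longrightarrow> (\<Sum>i<n. norm (f (v i) - f (u i))) < e"
  proof (intro exI[of _ d] conjI allI impI \<open>d > 0\<close>)
    fix n :: nat and u v :: "nat \<Rightarrow> real"
    assume "\<forall>i<n. a' \<le> u i \<and> u i \<le> v i \<and> v i \<le> b'"
    then have "\<forall>i<n. a \<le> u i \<and> u i \<le> v i \<and> v i \<le> b"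
      using assms(2,3) by (meson order_trans)
    then show "(\<Sum>i<n. norm (f (v i) - f (u i))) < e"
      if "disjoint_family_on (\<lambda>i. {u i <..< v i}) {..<n}" "(\<Sum>i<n. v i - u i) < d"
      using that d by simp
  qed
qed

lemma abs_continuous_on_interval_imp_continuous_on:
  assumes "abs_continuous_on_interval a b f"
  shows "continuous_on {a..b} f"
  unfolding continuous_on_iff
proof (intro ballI allI impI)
  fix x e :: real assume x: "x \<in> {a..b}" and "e > 0"
  obtain d where "d > 0" and d: "\<forall>I (u :: unit \<Rightarrow> real) v. finite I \<longrightarrow> (\<forall>i\<in>I. a \<le> u i \<and> u i \<le> v i \<and> v i \<le> b) \<longrightarrow>
      disjoint_family_on (\<lambda>i. {u i<..<v i}) I \<longrightarrow> (\<Sum>i\<in>I. v i - u i) < d \<longrightarrow>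
      (\<Sum>i\<in>I. norm (f (v i) - f (u i))) < e"
    by (rule abs_continuous_on_intervalD_finite[OF assms \<open>e > 0\<close>], erule that)
  have "dist (f y) (f x) < e" if "y \<in> {a..b}" "dist y x < d" for y
  proof -
    \<comment> \<open>One interval suffices, hence the index type \<open>unit\<close>;
      \<open>min\<close> and \<open>max\<close> cover both positions of \<open>y\<close> relative to
      \<open>x\<close>.\<close>
    have "(\<Sum>i\<in>{()}. norm (f (max x y) - f (min x y))) < e"
      using x that by (intro d[rule_format]) (auto simp: disjoint_family_on_def dist_real_def)
    then show ?thesis
      by (simp add: dist_norm min_def max_def norm_minus_commute split: if_splits)
  qed
  then show "\<exists>d>0. \<forall>y\<in>{a..b}. dist y x < d \<longrightarrow> dist (f y) (f x) < e"
    using \<open>d > 0\<close> by blast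
qed

lemma abs_continuous_on_interval_lipschitz:
  assumes f: "\<And>s t. s \<in> {a..b} \<Longrightarrow> t \<in> {a..b} \<Longrightarrow> norm (f t - f s) \<le> L * \<bar>t - s\<bar>"
  shows "abs_continuous_on_interval a b f"
  unfolding abs_continuous_on_interval_def
proof (intro allI impI)
  fix e :: real assume "e > 0"
  \<comment> \<open>A positive constant, so that dividing by it is legitimate whatever the sign of
    \<open>L\<close>.\<close>
  let ?L = "\<bar>L\<bar> + 1"
  show "\<exists>d>0. \<forall>(n::nat) u v. (\<forall>i<n. a \<le> u i \<and> u i \<le> v i \<and> v i \<le> b) \<longrightarrow>
      disjoint_family_on (\<lambda>i. {u i <..< v i}) {..<n} \<longrightarrow>
      (\<Sum>i<n. v i - u i) < d \<longrightarrow> (\<Sum>i<n. norm (f (v i) - f (u i))) < e"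
  proof (intro exI[of _ "e / ?L"] conjI allI impI)
    show "0 < e / ?L" using \<open>e > 0\<close> by simp
    fix n :: nat and u v :: "nat \<Rightarrow> real"
    assume uv: "\<forall>i<n. a \<le> u i \<and> u i \<le> v i \<and> v i \<le> b" and less: "(\<Sum>i<n. v i - u i) < e / ?L"
    have "norm (f (v i) - f (u i)) \<le> ?L * (v i - u i)" if "i < n" for i
    proof -
      have i: "a \<le> u i" "u i \<le> v i" "v i \<le> b" using uv that by auto
      then have "norm (f (v i) - f (u i)) \<le> L * (v i - u i)"
        using f[of "u i" "v i"] by simp
      also have "\<dots> \<le> ?L * (v i - u i)"
        using i by (intro mult_right_mono) auto
      finally show ?thesis .
    qed
    then have "(\<Sum>i<n. norm (f (v i) - f (u i))) \<le> ?L * (\<Sum>i<n. v i - u i)"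
      unfolding sum_distrib_left by (intro sum_mono) auto
    also have "\<dots> < ?L * (e / ?L)"
      by (rule mult_strict_left_mono[OF less]) simp
    finally show "(\<Sum>i<n. norm (f (v i) - f (u i))) < e"
      by (simp add: divide_simps)
  qed
qed

section \<open>Closure of absolute continuity under sums, differences and bilinear products\<close>

lemma abs_continuous_on_interval_const: "abs_continuous_on_interval a b (\<lambda>_. c)"
  by (rule abs_continuous_on_interval_lipschitz[where L = 0]) simp

lemma abs_continuous_on_interval_ident: "abs_continuous_on_interval a b (\<lambda>t. t)"
  by (rule abs_continuous_on_interval_lipschitz[where L = 1]) simp

text \<open>Common core of the closure rules: families of intervals short enough for both
  \<open>f\<close> and \<open>g\<close> are short enough for \<open>h\<close>, each function
  contributing at most half of the allowed error.\<close>

lemma abs_continuous_on_interval_dominated: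
  fixes f :: "real \<Rightarrow> 'a::real_normed_vector" and g :: "real \<Rightarrow> 'b::real_normed_vector"
    and h :: "real \<Rightarrow> 'c::real_normed_vector"
  assumes f: "abs_continuous_on_interval a b f" and g: "abs_continuous_on_interval a b g"
    and h: "\<And>s t. s \<in> {a..b} \<Longrightarrow> t \<in> {a..b} \<Longrightarrow>
      norm (h t - h s) \<le> L * (norm (f t - f s) + norm (g t - g s))"
  shows "abs_continuous_on_interval a b h"
  unfolding abs_continuous_on_interval_def
proof (intro allI impI)
  fix e :: real assume "e > 0"
  define M where "M = \<bar>L\<bar> + 1"
  then have "M > 0" by simp
  have e': "e / (2 * M) > 0" using \<open>e > 0\<close> \<open>M > 0\<close> by simp
  obtain d1 where "d1 > 0" and d1: "\<forall>(n::nat) u v. (\<forall>i<n. a \<le> u i \<and> u i \<le> v i \<and> v i \<le> b) \<longrightarrow>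
      disjoint_family_on (\<lambda>i. {u i <..< v i}) {..<n} \<longrightarrow>
      (\<Sum>i<n. v i - u i) < d1 \<longrightarrow>
      (\<Sum>i<n. norm (f (v i) - f (u i))) < e / (2 * M)"
    by (rule abs_continuous_on_intervalE[OF f e'], erule that)
  obtain d2 where "d2 > 0" and d2: "\<forall>(n::nat) u v. (\<forall>i<n. a \<le> u i \<and> u i \<le> v i \<and> v i \<le> b) \<longrightarrow>
      disjoint_family_on (\<lambda>i. {u i <..< v i}) {..<n} \<longrightarrow>
      (\<Sum>i<n. v i - u i) < d2 \<longrightarrow>
      (\<Sum>i<n. norm (g (v i) - g (u i))) < e / (2 * M)"
    by (rule abs_continuous_on_intervalE[OF g e'], erule that)
  show "\<exists>d>0. \<forall>(n::nat) u v. (\<forall>i<n. a \<le> u i \<and> u i \<le> v i \<and> v i \<le> b) \<longrightarrow>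
      disjoint_family_on (\<lambda>i. {u i <..< v i}) {..<n} \<longrightarrow>
      (\<Sum>i<n. v i - u i) < d \<longrightarrow> (\<Sum>i<n. norm (h (v i) - h (u i))) < e"
  proof (intro exI[of _ "min d1 d2"] conjI allI impI)
    show "0 < min d1 d2" using \<open>d1 > 0\<close> \<open>d2 > 0\<close> by simp
    fix n :: nat and u v :: "nat \<Rightarrow> real"
    assume uv: "\<forall>i<n. a \<le> u i \<and> u i \<le> v i \<and> v i \<le> b"
      and dis: "disjoint_family_on (\<lambda>i. {u i <..< v i}) {..<n}"
      and less: "(\<Sum>i<n. v i - u i) < min d1 d2"
    have "norm (h (v i) - h (u i)) \<le> M * (norm (f (v i) - f (u i)) + norm (g (v i) - g (u i)))"
      if "i < n" for i
    proof -
      have "norm (h (v i) - h (u i)) \<le> L * (norm (f (v i) - f (u i)) + norm (g (v i) - g (u i)))"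
      proof (rule h)
        have "a \<le> u i" "u i \<le> v i" "v i \<le> b" using uv that by auto
        then show "u i \<in> {a..b}" "v i \<in> {a..b}" by auto
      qed
      also have "\<dots> \<le> M * (norm (f (v i) - f (u i)) + norm (g (v i) - g (u i)))"
        by (intro mult_right_mono) (auto simp: M_def)
      finally show ?thesis .
    qed
    then have "(\<Sum>i<n. norm (h (v i) - h (u i))) \<le>
        (\<Sum>i<n. M * (norm (f (v i) - f (u i)) + norm (g (v i) - g (u i))))"
      by (intro sum_mono) auto
    also have "\<dots> = M * ((\<Sum>i<n. norm (f (v i) - f (u i))) + (\<Sum>i<n. norm (g (v i) - g (u i))))"
      by (simp only: sum_distrib_left sum.distrib distrib_left)
    also have "\<dots> < M * (e / (2 * M) + e / (2 * M))"
    proof (intro mult_strict_left_mono add_strict_mono)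
      show "(\<Sum>i<n. norm (f (v i) - f (u i))) < e / (2 * M)"
        using d1 uv dis less by simp
      show "(\<Sum>i<n. norm (g (v i) - g (u i))) < e / (2 * M)"
        using d2 uv dis less by simp
    qed (use \<open>M > 0\<close> in simp)
    also have "\<dots> = e" using \<open>M > 0\<close> by (simp add: field_simps)
    finally show "(\<Sum>i<n. norm (h (v i) - h (u i))) < e" .
  qed
qed

lemma abs_continuous_on_interval_add:
  assumes "abs_continuous_on_interval a b f" "abs_continuous_on_interval a b g"
  shows "abs_continuous_on_interval a b (\<lambda>t. f t + g t)"
proof (rule abs_continuous_on_interval_dominated[OF assms, where L = 1])
  show "norm (f t + g t - (f s + g s)) \<le> 1 * (norm (f t - f s) + norm (g t - g s))" for s t
    using norm_triangle_ineq[of "f t - f s" "g t - g s"] by (simp add: algebra_simps)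
qed

lemma abs_continuous_on_interval_diff:
  assumes "abs_continuous_on_interval a b f" "abs_continuous_on_interval a b g"
  shows "abs_continuous_on_interval a b (\<lambda>t. f t - g t)"
proof (rule abs_continuous_on_interval_dominated[OF assms, where L = 1])
  show "norm (f t - g t - (f s - g s)) \<le> 1 * (norm (f t - f s) + norm (g t - g s))" for s t
    using norm_triangle_ineq4[of "f t - f s" "g t - g s"] by (simp add: algebra_simps)
qed

text \<open>Both factors are continuous on a compact interval, hence bounded, so the increment of
  the product is dominated by the increments of the factors.\<close>

lemma (in bounded_bilinear) abs_continuous_on_interval:
  assumes f: "abs_continuous_on_interval l u f" and g: "abs_continuous_on_interval l u g"
  shows "abs_continuous_on_interval l u (\<lambda>t. prod (f t) (g t))"
proof -
  obtain K where "K \<ge> 0" and K: "\<And>x y. norm (prod x y) \<le> norm x * norm y * K"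
    using nonneg_bounded by blast
  have "bounded (f ` {l..u})" "bounded (g ` {l..u})"
    by (intro compact_imp_bounded compact_continuous_image compact_Icc
        abs_continuous_on_interval_imp_continuous_on f g)+
  then obtain F G where F: "\<And>t. t \<in> {l..u} \<Longrightarrow> norm (f t) \<le> F"
    and G: "\<And>t. t \<in> {l..u} \<Longrightarrow> norm (g t) \<le> G"
    unfolding bounded_iff by blast
  show ?thesis
  proof (rule abs_continuous_on_interval_dominated[OF f g, where L = "K * (F + G)"])
    fix s t assume st: "s \<in> {l..u}" "t \<in> {l..u}"
    let ?df = "norm (f t - f s)" and ?dg = "norm (g t - g s)"
    have FG: "0 \<le> F" "0 \<le> G"
      using order_trans[OF norm_ge_zero F[OF st(1)]] order_trans[OF norm_ge_zero G[OF st(1)]] by auto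
    have "prod (f t) (g t) - prod (f s) (g s) = prod (f t - f s) (g t) + prod (f s) (g t - g s)"
      by (simp add: diff_left diff_right)
    then have "norm (prod (f t) (g t) - prod (f s) (g s)) \<le>
        norm (prod (f t - f s) (g t)) + norm (prod (f s) (g t - g s))"
      using norm_triangle_ineq by simp
    also have "\<dots> \<le> ?df * norm (g t) * K + norm (f s) * ?dg * K"
      by (intro add_mono K)
    \<comment> \<open>Enlarging both bounds to \<open>F + G\<close> gives the two terms the common
      constant that domination asks for.\<close>
    also have "\<dots> \<le> ?df * (F + G) * K + (F + G) * ?dg * K"
      using F[OF st(1)] G[OF st(2)] FG \<open>K \<ge> 0\<close>
      by (intro add_mono mult_right_mono mult_left_mono) auto
    finally show "norm (prod (f t) (g t) - prod (f s) (g s)) \<le> K * (F + G) * (?df + ?dg)"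
      by (simp add: algebra_simps)
  qed
qed

lemmas abs_continuous_on_interval_inner = bounded_bilinear.abs_continuous_on_interval[OF bounded_bilinear_inner]
lemmas abs_continuous_on_interval_mult = bounded_bilinear.abs_continuous_on_interval[OF bounded_bilinear_mult]

section \<open>Monotonicity from the sign of an almost everywhere derivative\<close>

lemma sum_length_disjoint_intervals_le:
  fixes u v :: "'i \<Rightarrow> real"
  assumes "finite I" "\<And>i. i \<in> I \<Longrightarrow> u i \<le> v i" "disjoint_family_on (\<lambda>i. {u i<..<v i}) I"
    and U: "(\<Union>i\<in>I. {u i<..<v i}) \<subseteq> U" "U \<in> lmeasurable"
  shows "(\<Sum>i\<in>I. v i - u i) \<le> measure lebesgue U"
proof -
  have "(\<Sum>i\<in>I. v i - u i) = (\<Sum>i\<in>I. measure lebesgue {u i<..<v i})"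
    using assms(2) by (intro sum.cong) auto
  also have "\<dots> = measure lebesgue (\<Union>i\<in>I. {u i<..<v i})"
    using assms(1-3) by (intro measure_finite_Union[symmetric]) auto
  also have "\<dots> \<le> measure lebesgue U"
    using assms(1) U by (intro measure_mono_fmeasurable sets.finite_UN) auto
  finally show ?thesis .
qed

text \<open>Cousin's lemma replaces the usual covering argument: on a sufficiently fine tagged division,
  the pieces tagged in the exceptional set \<open>N\<close> have small total length, hence contribute little by
  absolute continuity.\<close>

lemma abs_continuous_nonincreasing:
  fixes f :: "real \<Rightarrow> real"
  assumes "a \<le> b" and ac: "abs_continuous_on_interval a b f" and N: "negligible N"
    and deriv: "\<And>t. t \<in> {a..b} - N \<Longrightarrow> \<exists>D\<le>0. (f has_real_derivative D) (at t within {a..b})"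
  shows "f b \<le> f a"
proof (rule field_le_epsilon)
  fix e :: real assume "e > 0"
  \<comment> \<open>Half of the error is spent as a slope \<open>c\<close> on the pieces tagged
    outside \<open>N\<close>, the other half on those tagged in \<open>N\<close>. Adding 1 keeps the
    denominator positive when \<open>a = b\<close>.\<close>
  define c where "c = e / 2 / (b - a + 1)"
  have "c > 0" "c * (b - a) \<le> e / 2"
    using \<open>e > 0\<close> \<open>a \<le> b\<close> by (auto simp: c_def field_simps)
  have "e / 2 > 0" using \<open>e > 0\<close> by simp
  obtain d where "d > 0" and d: "\<forall>I u v. finite I \<longrightarrow> (\<forall>i\<in>I. a \<le> u i \<and> u i \<le> v i \<and> v i \<le> b) \<longrightarrow>
      disjoint_family_on (\<lambda>i. {u i<..<v i}) I \<longrightarrow> (\<Sum>i\<in>(I::(real \<times> real set) set). v i - u i) < d \<longrightarrow>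
      (\<Sum>i\<in>I. norm (f (v i) - f (u i))) < e / 2"
    by (rule abs_continuous_on_intervalD_finite[OF ac \<open>e / 2 > 0\<close>], erule that)
  have "N \<in> sets lebesgue" "emeasure lebesgue N = 0"
    using N by (auto simp: negligible_iff_null_sets)
  \<comment> \<open>Outer regularity: \<open>U\<close> covers \<open>N\<close> and is so small that
    disjoint intervals inside it have total length below the \<open>d\<close> of absolute
    continuity.\<close>
  then obtain U where "open U" "N \<subseteq> U" and U: "U - N \<in> lmeasurable" "emeasure lebesgue (U - N) < ennreal d"
    using sets_lebesgue_outer_open[OF _ \<open>d > 0\<close>] by metis
  have "U = (U - N) \<union> N" using \<open>N \<subseteq> U\<close> by blast
  then have lmU: "U \<in> lmeasurable"
    using fmeasurable.Un[OF U(1) negligible_imp_measurable[OF N]] by simp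
  have "measure lebesgue U = measure lebesgue (U - N)"
    by (rule measure_negligible_symdiff[symmetric]) (use N lmU in \<open>auto elim: negligible_subset\<close>)
  moreover have "measure lebesgue (U - N) < d"
    using U \<open>d > 0\<close> by (simp add: emeasure_eq_measure2 ennreal_less_iff)
  ultimately have mU: "measure lebesgue U < d" by simp
  \<comment> \<open>The radii form the gauge: an interval tagged in \<open>N\<close> must stay
    inside \<open>U\<close>, any other must satisfy the slope bound.\<close>
  have "\<exists>r>0. \<forall>u v. a \<le> u \<longrightarrow> u \<le> t \<longrightarrow> t \<le> v \<longrightarrow> v \<le> b \<longrightarrow> {u..v} \<subseteq> ball t r \<longrightarrow>
      (if t \<in> N then {u..v} \<subseteq> U else f v - f u \<le> c * (v - u))" for t
  proof (cases "t \<in> {a..b} - N")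
    case True
    then obtain D where "D \<le> 0" and D: "(f has_real_derivative D) (at t within {a..b})"
      using deriv by blast
    then obtain r where "r > 0" and r: "\<And>y. y \<in> {a..b} \<Longrightarrow> norm (y - t) < r \<Longrightarrow>
        norm (f y - f t - (y - t) * D) \<le> c * norm (y - t)"
      using \<open>c > 0\<close> unfolding has_field_derivative_def has_derivative_within_alt
      by (metis mult.commute)
    \<comment> \<open>Straddle estimate: as \<open>t\<close> lies between \<open>u\<close> and
      \<open>v\<close>, the differentiability errors on the two sides add up to
      \<open>c * (v - u)\<close>, and the linear terms have a favourable sign because
      \<open>D \<le> 0\<close>.\<close>
    have "f v - f u \<le> c * (v - u)"
      if "a \<le> u" "u \<le> t" "t \<le> v" "v \<le> b" "{u..v} \<subseteq> ball t r" for u v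
    proof -
      have "u \<in> {u..v}" "v \<in> {u..v}" using that by auto
      then have "u \<in> ball t r" "v \<in> ball t r" using that(5) by blast+
      then have "\<bar>f v - f t - (v - t) * D\<bar> \<le> c * (v - t)" "\<bar>f u - f t - (u - t) * D\<bar> \<le> c * (t - u)"
        using r[of v] r[of u] that by (auto simp: dist_real_def)
      moreover have "(v - t) * D \<le> 0" "(u - t) * D \<ge> 0"
        using \<open>D \<le> 0\<close> that by (auto simp: mult_le_0_iff zero_le_mult_iff)
      moreover have "c * (v - u) = c * (v - t) + c * (t - u)" by (simp add: algebra_simps)
      ultimately show ?thesis by argo
    qed
    then show ?thesis using \<open>r > 0\<close> True by auto
  next
    case False
    show ?thesis
    proof (cases "t \<in> N")
      case True
      then obtain r where "r > 0" "ball t r \<subseteq> U"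
        using \<open>open U\<close> \<open>N \<subseteq> U\<close> by (metis open_contains_ball subsetD)
      then show ?thesis using True by (intro exI[of _ r]) auto
    next
      \<comment> \<open>Here \<open>t\<close> lies outside \<open>{a..b}\<close>, so no admissible
        interval contains it and any radius will do.\<close>
      case False
      with \<open>t \<notin> {a..b} - N\<close> show ?thesis by (intro exI[of _ 1]) auto
    qed
  qed
  then obtain r where r: "\<And>t. r t > 0" and fine: "\<And>t u v. \<lbrakk>a \<le> u; u \<le> t; t \<le> v; v \<le> b;
      {u..v} \<subseteq> ball t (r t)\<rbrakk> \<Longrightarrow> (if t \<in> N then {u..v} \<subseteq> U else f v - f u \<le> c * (v - u))"
    by metis
  obtain p where p: "p tagged_division_of {a..b}" "(\<lambda>t. ball t (r t)) fine p"
    using fine_division_exists_real gauge_ball_dependent r by metis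
  have finp: "finite p" using p by auto
  \<comment> \<open>Every piece is a nonempty compact interval, so \<open>Inf\<close> and
    \<open>Sup\<close> recover its end points; this is also the form in which telescoping over a
    tagged division is available.\<close>
  have K: "Inf K \<le> t" "t \<le> Sup K" "K = {Inf K..Sup K}" "a \<le> Inf K" "Sup K \<le> b" "{Inf K..Sup K} \<subseteq> ball t (r t)"
    if tK: "(t, K) \<in> p" for t K
  proof -
    obtain u v where uv: "K = {u..v}" using tagged_division_ofD(4)[OF p(1) tK] by auto
    moreover have "t \<in> K" "K \<subseteq> {a..b}" using tagged_division_ofD(2,3)[OF p(1) tK] by auto
    moreover have "K \<subseteq> ball t (r t)" using p(2) tK unfolding fine_def by auto
    ultimately have "u \<le> v" "a \<le> u" "v \<le> b" "t \<in> {u..v}" "{u..v} \<subseteq> ball t (r t)" by auto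
    then show "Inf K \<le> t" "t \<le> Sup K" "K = {Inf K..Sup K}" "a \<le> Inf K" "Sup K \<le> b" "{Inf K..Sup K} \<subseteq> ball t (r t)"
      using uv by auto
  qed
  define len where "len = (\<lambda>(t::real, K::real set). Sup K - Inf K)"
  define incr where "incr = (\<lambda>(t::real, K). f (Sup K) - f (Inf K))"
  define q where "q = {i \<in> p. fst i \<in> N}"
  have "q \<subseteq> p" and "finite q" using finp by (auto simp: q_def)
  have disj: "disjoint_family_on (\<lambda>i. {Inf (snd i)<..<Sup (snd i)}) q"
    unfolding disjoint_family_on_def
  proof (intro ballI impI)
    fix i j assume "i \<in> q" "j \<in> q" "i \<noteq> j"
    then have ij: "(fst i, snd i) \<in> p" "(fst j, snd j) \<in> p" "(fst i, snd i) \<noteq> (fst j, snd j)"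
      using \<open>q \<subseteq> p\<close> by auto
    have "interior (snd i) \<inter> interior (snd j) = {}"
      using tagged_division_ofD(5)[OF p(1) ij] .
    moreover have "interior (snd i) = {Inf (snd i)<..<Sup (snd i)}" "interior (snd j) = {Inf (snd j)<..<Sup (snd j)}"
      using K(3)[OF ij(1)] K(3)[OF ij(2)] by (metis interior_atLeastAtMost_real)+
    ultimately show "{Inf (snd i)<..<Sup (snd i)} \<inter> {Inf (snd j)<..<Sup (snd j)} = {}" by simp
  qed
  have bounds: "\<forall>i\<in>q. a \<le> Inf (snd i) \<and> Inf (snd i) \<le> Sup (snd i) \<and> Sup (snd i) \<le> b"
  proof
    fix i assume "i \<in> q"
    then have "(fst i, snd i) \<in> p" using \<open>q \<subseteq> p\<close> by auto
    from K(1,2,4,5)[OF this]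
    show "a \<le> Inf (snd i) \<and> Inf (snd i) \<le> Sup (snd i) \<and> Sup (snd i) \<le> b" by simp
  qed
  have fine_K: "if fst i \<in> N then {Inf (snd i)..Sup (snd i)} \<subseteq> U
      else f (Sup (snd i)) - f (Inf (snd i)) \<le> c * (Sup (snd i) - Inf (snd i))" if "i \<in> p" for i
  proof -
    have "(fst i, snd i) \<in> p" using that by simp
    note K = K[OF this]
    show ?thesis by (rule fine[OF K(4,1,2,5,6)])
  qed
  have "{Inf (snd i)<..<Sup (snd i)} \<subseteq> U" if "i \<in> q" for i
  proof -
    have "{Inf (snd i)..Sup (snd i)} \<subseteq> U"
      using fine_K[of i] that by (simp add: q_def)
    then show ?thesis
      using greaterThanLessThan_subseteq_atLeastAtMost_iff by blast
  qed
  then have "(\<Union>i\<in>q. {Inf (snd i)<..<Sup (snd i)}) \<subseteq> U"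
    by blast
  then have "(\<Sum>i\<in>q. Sup (snd i) - Inf (snd i)) \<le> measure lebesgue U"
    by (intro sum_length_disjoint_intervals_le[OF \<open>finite q\<close> _ disj _ lmU]) (use bounds in simp)
  also note mU
  finally have small: "(\<Sum>i\<in>q. norm (f (Sup (snd i)) - f (Inf (snd i)))) < e / 2"
    using \<open>finite q\<close> bounds disj
    by (intro d[THEN spec, THEN spec, THEN spec, THEN mp, THEN mp, THEN mp, THEN mp])
  have "sum incr q \<le> (\<Sum>i\<in>q. norm (f (Sup (snd i)) - f (Inf (snd i))))"
    unfolding incr_def by (intro sum_mono) (simp add: case_prod_unfold)
  also note small
  finally have 1: "sum incr q \<le> e / 2" by simp
  have "sum incr (p - q) \<le> (\<Sum>i\<in>p - q. c * len i)"
  proof (intro sum_mono)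
    fix i assume "i \<in> p - q"
    then show "incr i \<le> c * len i"
      using fine_K[of i] by (simp add: q_def incr_def len_def case_prod_unfold)
  qed
  \<comment> \<open>Including the nonnegative lengths from \<open>q\<close> makes the sum telescope
    to \<open>b - a\<close>.\<close>
  also have "\<dots> \<le> (\<Sum>i\<in>p. c * len i)"
  proof (rule sum_mono2[OF finp])
    fix i assume "i \<in> p - (p - q)"
    then have "Inf (snd i) \<le> Sup (snd i)" using bounds by simp
    then show "0 \<le> c * len i" using \<open>c > 0\<close> by (simp add: len_def case_prod_unfold)
  qed auto
  also have "\<dots> = c * (b - a)"
    using additive_tagged_division_1[OF \<open>a \<le> b\<close> p(1), of "\<lambda>t. t"]
    by (simp add: len_def flip: sum_distrib_left)
  also have "\<dots> \<le> e / 2" by fact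
  finally have 2: "sum incr (p - q) \<le> e / 2" .
  have "f b - f a = sum incr p"
    using additive_tagged_division_1[OF \<open>a \<le> b\<close> p(1), of f] by (simp add: incr_def)
  also have "\<dots> = sum incr (p - q) + sum incr q"
    using sum.subset_diff[OF \<open>q \<subseteq> p\<close> finp] .
  finally show "f b \<le> f a + e" using 1 2 by simp
qed

text \<open>Subtracting the linear function with slope \<open>m\<close> reduces this to the
  nonincreasing case.\<close>

lemma abs_continuous_mean_value_le:
  fixes f :: "real \<Rightarrow> real"
  assumes "a \<le> b" and ac: "abs_continuous_on_interval a b f" and N: "negligible N"
    and deriv: "\<And>t. t \<in> {a..b} - N \<Longrightarrow> \<exists>D\<le>m. (f has_real_derivative D) (at t within {a..b})"
  shows "f b - f a \<le> m * (b - a)"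
proof -
  have "f b + (- m) * b \<le> f a + (- m) * a"
  proof (rule abs_continuous_nonincreasing[OF \<open>a \<le> b\<close> _ N])
    show "abs_continuous_on_interval a b (\<lambda>t. f t + (- m) * t)"
      by (intro abs_continuous_on_interval_add abs_continuous_on_interval_mult
          abs_continuous_on_interval_const abs_continuous_on_interval_ident ac)
    fix t assume "t \<in> {a..b} - N"
    then obtain D where "D \<le> m" "(f has_real_derivative D) (at t within {a..b})"
      using deriv by blast
    then show "\<exists>D\<le>0. ((\<lambda>t. f t + (- m) * t) has_real_derivative D) (at t within {a..b})"
      by (intro exI[of _ "D - m"]) (auto intro!: derivative_eq_intros)
  qed
  then show ?thesis by (simp add: algebra_simps)
qed

subsection \<open>Weak convergence in Hilbert space\<close>

text \<open>Points of almost minimal norm in the sets form a Cauchy sequence by the parallelogram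
  law, and their limit lies in every set. This takes the place of weak compactness.\<close>

lemma decreasing_closed_convex_Inter_nonempty:
  fixes C :: "nat \<Rightarrow> 'a::{real_inner, complete_space} set"
  assumes convex: "\<And>n. convex (C n)" and closed: "\<And>n. closed (C n)" and ne: "\<And>n. C n \<noteq> {}"
    and bdd: "bounded (C 0)" and dec: "decseq C"
  shows "(\<Inter>n. C n) \<noteq> {}"
proof -
  \<comment> \<open>Squared distance from the origin to \<open>C n\<close>: it grows as the sets
    shrink and stays bounded because \<open>C 0\<close> is bounded.\<close>
  define d where "d n = (INF u\<in>C n. (norm u)\<^sup>2)" for n
  have bdd_below: "bdd_below ((\<lambda>u. (norm u)\<^sup>2) ` C n)" for n
    by (intro bdd_belowI2[where m = 0]) auto
  have d_le: "d n \<le> (norm u)\<^sup>2" if "u \<in> C n" for u n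
    unfolding d_def by (intro cINF_lower bdd_below that)
  have sub: "C n \<subseteq> C m" if "m \<le> n" for m n
    using dec that by (simp add: decseq_def)
  have "incseq d"
    unfolding incseq_def d_def
    by (intro allI impI cINF_superset_mono ne bdd_below sub) auto
  moreover obtain B where B: "\<And>u. u \<in> C 0 \<Longrightarrow> norm u \<le> B"
    using bdd by (auto simp: bounded_iff)
  have "d n \<le> B\<^sup>2" for n
  proof -
    obtain u where "u \<in> C n" using ne by blast
    moreover have "norm u \<le> B" using \<open>u \<in> C n\<close> sub[of 0 n] B by auto
    ultimately show ?thesis using d_le[of u n] power_mono[of "norm u" B 2] by simp
  qed
  ultimately obtain D where D: "d \<longlonglongrightarrow> D" "\<And>n. d n \<le> D"
    using incseq_convergent[of d "B\<^sup>2"] by blast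
  have "\<exists>u\<in>C n. (norm u)\<^sup>2 < d n + inverse (real (Suc n))" for n
    using cInf_lessD[of "(\<lambda>u. (norm u)\<^sup>2) ` C n" "d n + inverse (real (Suc n))"] ne
    unfolding d_def by auto
  then obtain u where u: "\<And>n. u n \<in> C n" "\<And>n. (norm (u n))\<^sup>2 < d n + inverse (real (Suc n))"
    by metis
  \<comment> \<open>Bound for the squared distance between \<open>u n\<close> and later terms; it
    vanishes since \<open>d\<close> converges to \<open>D\<close>.\<close>
  define r where "r n = 4 * (D - d n) + 4 * inverse (real (Suc n))" for n
  have "r \<longlonglongrightarrow> 4 * (D - D) + 4 * 0"
    unfolding r_def by (intro tendsto_intros D LIMSEQ_inverse_real_of_nat)
  then have r: "r \<longlonglongrightarrow> 0" by simp
  have close: "(norm (u n - u m))\<^sup>2 \<le> r m" if "m \<le> n" for m n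
  proof -
    \<comment> \<open>The midpoint stays in \<open>C m\<close>, so its norm cannot drop below the
      minimal one; this bounds the subtracted term of the parallelogram law from below.\<close>
    have "(1/2) *\<^sub>R u m + (1/2) *\<^sub>R u n \<in> C m"
      using convexD[OF convex[of m], of "u m" "u n" "1/2" "1/2"] u(1) sub[OF that] by auto
    from d_le[OF this] have "4 * d m \<le> (norm (u m + u n))\<^sup>2"
      by (simp add: power2_eq_square flip: scaleR_add_right)
    moreover have "(norm (u n - u m))\<^sup>2 = 2 * (norm (u n))\<^sup>2 + 2 * (norm (u m))\<^sup>2 - (norm (u m + u n))\<^sup>2"
      by (simp add: power2_norm_eq_inner inner_simps inner_commute)
    moreover have "inverse (real (Suc n)) \<le> inverse (real (Suc m))"
      using that by (intro le_imp_inverse_le) auto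
    ultimately show ?thesis
      using u(2)[of n] u(2)[of m] D(2)[of n] D(2)[of m] unfolding r_def by argo
  qed
  have "Cauchy u"
    unfolding Cauchy_altdef2
  proof (intro allI impI)
    fix e :: real assume "e > 0"
    then obtain m where "r m < e\<^sup>2"
      using order_tendstoD(2)[OF r, of "e\<^sup>2"] by (auto simp: eventually_sequentially)
    then have "dist (u n) (u m) < e" if "n \<ge> m" for n
      using close[OF that] \<open>e > 0\<close> by (auto simp: dist_norm intro: power2_less_imp_less)
    then show "\<exists>N. \<forall>n\<ge>N. dist (u n) (u N) < e" by blast
  qed
  then obtain l where l: "u \<longlonglongrightarrow> l"
    using Cauchy_convergent convergent_def by blast
  have "l \<in> C n" for n
  proof (rule Lim_in_closed_set[OF closed _ sequentially_bot l])
    show "\<forall>\<^sub>F k in sequentially. u k \<in> C n"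
      using eventually_ge_at_top[of n] by eventually_elim (use u(1) sub in blast)
  qed
  then show ?thesis by blast
qed

text \<open>Equivalently, \<open>u\<close> lies in the closed convex hull of every tail of \<open>x\<close>. Unlike weak cluster points,
  such points are obtained without weak compactness.\<close>

definition hull_cluster_point ::
    "('b \<Rightarrow> 'a::real_normed_vector) \<Rightarrow> 'b filter \<Rightarrow> 'a \<Rightarrow> bool" where
  "hull_cluster_point x F u \<longleftrightarrow>
    (\<forall>C. convex C \<longrightarrow> closed C \<longrightarrow> (\<forall>\<^sub>F s in F. x s \<in> C) \<longrightarrow> u \<in> C)"

lemma hull_cluster_pointD:
  assumes "hull_cluster_point x F u" "convex C" "closed C" "\<forall>\<^sub>F s in F. x s \<in> C"
  shows "u \<in> C"
  using assms by (simp add: hull_cluster_point_def)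

lemma hull_cluster_point_mono:
  assumes "hull_cluster_point x F u" "F \<le> G"
  shows "hull_cluster_point x G u"
  using assms by (simp add: hull_cluster_point_def le_filter_def)

text \<open>The closed convex hulls of the tails restricted to \<open>P\<close> are nonempty because
  \<open>P\<close> holds frequently, and they decrease inside a ball; any common point works. The
  restriction to \<open>P\<close> serves to examine a selected set of times.\<close>

lemma hull_cluster_point_exists:
  fixes x :: "real \<Rightarrow> 'a::{real_inner, complete_space}"
  assumes freq: "\<exists>\<^sub>F s in at_top. P s" and bdd: "\<forall>\<^sub>F s in at_top. norm (x s) \<le> B"
  shows "\<exists>u. hull_cluster_point x (inf at_top (principal {s. P s})) u"
proof -
  obtain T where T: "\<And>s. s \<ge> T \<Longrightarrow> norm (x s) \<le> B"
    using bdd by (auto simp: eventually_at_top_linorder)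
  define K where "K n = (\<lambda>S. convex S \<and> closed S) hull (x ` {s. T + real n \<le> s \<and> P s})" for n
  have K: "convex (K n) \<and> closed (K n)" for n
    unfolding K_def by (rule hull_in) (auto intro: convex_Inter)
  have "(\<Inter>n. K n) \<noteq> {}"
  proof (rule decreasing_closed_convex_Inter_nonempty)
    show "K n \<noteq> {}" for n
    proof -
      have "\<exists>\<^sub>F s in at_top. T + real n \<le> s \<and> P s"
        using frequently_eventually_frequently[OF freq eventually_ge_at_top[of "T + real n"]]
        by (simp add: conj_commute)
      then obtain s where "T + real n \<le> s \<and> P s"
        using frequently_ex by blast
      then have "x s \<in> x ` {s. T + real n \<le> s \<and> P s}" by simp
      then have "x s \<in> K n"
        unfolding K_def by (rule hull_inc)
      then show ?thesis by blast
    qed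
    have "K 0 \<subseteq> cball 0 B"
      unfolding K_def by (rule hull_minimal) (auto simp: T)
    then show "bounded (K 0)"
      using bounded_cball bounded_subset by blast
    show "decseq K"
      unfolding decseq_def K_def by (intro allI impI hull_mono image_mono) auto
  qed (use K in auto)
  then obtain u where u: "\<And>n. u \<in> K n" by blast
  have "u \<in> C" if C: "convex C" "closed C" "\<forall>\<^sub>F s in at_top. P s \<longrightarrow> x s \<in> C" for C
  proof -
    obtain S where S: "\<And>s. s \<ge> S \<Longrightarrow> P s \<Longrightarrow> x s \<in> C"
      using C(3) by (auto simp: eventually_at_top_linorder)
    obtain n where "S - T \<le> real n" using real_arch_simple by blast
    then have "K n \<subseteq> C"
      unfolding K_def by (intro hull_minimal) (use C S in auto)
    with u show "u \<in> C" by blast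
  qed
  then have "hull_cluster_point x (inf at_top (principal {s. P s})) u"
    by (simp add: hull_cluster_point_def eventually_inf_principal)
  then show ?thesis by blast
qed

text \<open>A half-space is closed and convex, so a linear inequality that holds eventually along
  \<open>x\<close> passes to \<open>u\<close>.\<close>

lemma hull_cluster_point_inner_le:
  assumes u: "hull_cluster_point x F u" and le: "\<forall>\<^sub>F s in F. x s \<bullet> y \<le> c"
  shows "u \<bullet> y \<le> c"
proof -
  have "\<forall>\<^sub>F s in F. x s \<in> {w. y \<bullet> w \<le> c}"
    using le by (simp add: inner_commute)
  from hull_cluster_pointD[OF u convex_halfspace_le closed_halfspace_le this]
  show ?thesis by (simp add: inner_commute)
qed

lemma hull_cluster_point_inner_eq:
  assumes u: "hull_cluster_point x F u" and L: "((\<lambda>s. x s \<bullet> y) \<longlongrightarrow> L) F"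
  shows "u \<bullet> y = L"
proof -
  \<comment> \<open>General in \<open>y\<close> and \<open>L\<close>, so that applying it to
    \<open>- y\<close> gives the reverse inequality.\<close>
  have le: "u \<bullet> y \<le> L" if "((\<lambda>s. x s \<bullet> y) \<longlongrightarrow> L) F" for y L
  proof (rule field_le_epsilon)
    fix e :: real assume "e > 0"
    then have "\<forall>\<^sub>F s in F. x s \<bullet> y < L + e"
      using order_tendstoD(2)[OF that] by simp
    then have "\<forall>\<^sub>F s in F. x s \<bullet> y \<le> L + e"
      by (rule eventually_mono) simp
    then show "u \<bullet> y \<le> L + e"
      by (rule hull_cluster_point_inner_le[OF u])
  qed
  have "((\<lambda>s. x s \<bullet> (- y)) \<longlongrightarrow> - L) F"
    using tendsto_minus[OF L] by simp
  from le[OF L] le[OF this] show ?thesis by simp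
qed

text \<open>Convergent distances leave room for one cluster point only; boundedness supplies one,
  and a failure of weak convergence would produce a second along the offending times.\<close>

lemma opial:
  fixes x :: "real \<Rightarrow> 'a::{real_inner, complete_space}"
  assumes "Z \<noteq> {}"
    and dist: "\<And>z. z \<in> Z \<Longrightarrow> \<exists>l. ((\<lambda>s. norm (x s - z)) \<longlongrightarrow> l) at_top"
    and cluster: "\<And>u. hull_cluster_point x at_top u \<Longrightarrow> u \<in> Z"
  shows "\<exists>z\<in>Z. converges_weakly x z at_top"
proof -
  obtain z0 l0 where "z0 \<in> Z" and l0: "((\<lambda>s. norm (x s - z0)) \<longlongrightarrow> l0) at_top"
    using assms(1) dist by blast
  have bdd: "\<forall>\<^sub>F s in at_top. norm (x s) \<le> l0 + 1 + norm z0"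
    using order_tendstoD(2)[OF l0, of "l0 + 1", simplified]
  proof eventually_elim
    case (elim s)
    then show ?case using norm_triangle_ineq[of "x s - z0" z0] by simp
  qed
  have unique: "u = u'" if u: "hull_cluster_point x at_top u" and u': "hull_cluster_point x at_top u'" for u u'
  proof -
    obtain l where l: "((\<lambda>s. norm (x s - u)) \<longlongrightarrow> l) at_top"
      using dist cluster u by blast
    obtain l' where l': "((\<lambda>s. norm (x s - u')) \<longlongrightarrow> l') at_top"
      using dist cluster u' by blast
    \<comment> \<open>The difference of the squared distances cancels
      \<open>x s \<bullet> x s\<close>, leaving an expression linear in \<open>x s\<close>. Its
      convergence forces \<open>u\<close> and \<open>u'\<close> to have the same inner product with
      \<open>u - u'\<close>.\<close>
    have eq: "x s \<bullet> (u - u') = ((norm (x s - u'))\<^sup>2 - (norm (x s - u))\<^sup>2 + u \<bullet> u - u' \<bullet> u') / 2" for s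
      by (simp add: power2_norm_eq_inner inner_diff_left inner_diff_right inner_commute)
    have "((\<lambda>s. x s \<bullet> (u - u')) \<longlongrightarrow> (l'\<^sup>2 - l\<^sup>2 + u \<bullet> u - u' \<bullet> u') / 2) at_top"
      unfolding eq by (intro tendsto_intros l l') auto
    from hull_cluster_point_inner_eq[OF u this] hull_cluster_point_inner_eq[OF u' this]
    have "(u - u') \<bullet> (u - u') = 0" by (simp add: inner_diff_left)
    then show ?thesis by simp
  qed
  have "\<exists>\<^sub>F s in at_top::real filter. True" by simp
  from hull_cluster_point_exists[OF this bdd] obtain z where z: "hull_cluster_point x at_top z"
    using hull_cluster_point_mono inf_le1 by blast
  \<comment> \<open>Only the upper estimate is proved; \<open>- y\<close> in place of
    \<open>y\<close> gives the lower one.\<close>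
  have ev_less: "\<forall>\<^sub>F s in at_top. x s \<bullet> y < z \<bullet> y + e" if "e > 0" for y e
  proof (rule ccontr)
    assume "\<not> ?thesis"
    then have freq: "\<exists>\<^sub>F s in at_top. z \<bullet> y + e \<le> x s \<bullet> y"
      by (simp add: not_eventually not_less)
    let ?G = "inf at_top (principal {s. z \<bullet> y + e \<le> x s \<bullet> y})"
    obtain u where u: "hull_cluster_point x ?G u"
      using hull_cluster_point_exists[OF freq bdd] by blast
    have "\<forall>\<^sub>F s in ?G. x s \<bullet> (- y) \<le> - (z \<bullet> y + e)"
      by (simp add: eventually_inf_principal)
    from hull_cluster_point_inner_le[OF u this] have "z \<bullet> y + e \<le> u \<bullet> y" by simp
    moreover have "hull_cluster_point x at_top u"
      by (rule hull_cluster_point_mono[OF u inf_le1])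
    then have "u = z" using z by (rule unique)
    ultimately show False using that by simp
  qed
  have "converges_weakly x z at_top"
    unfolding converges_weakly_def
  proof (intro allI order_tendstoI)
    fix y c assume "z \<bullet> y < c"
    then show "\<forall>\<^sub>F s in at_top. x s \<bullet> y < c"
      using ev_less[of "c - z \<bullet> y" y] by simp
  next
    fix y c assume "c < z \<bullet> y"
    then show "\<forall>\<^sub>F s in at_top. c < x s \<bullet> y"
      using ev_less[of "z \<bullet> y - c" "- y"] by simp
  qed
  then show ?thesis using cluster z by blast
qed

section \<open>Cluster points as zeros of a monotone operator\<close>

lemma zero_of_monotone_if_Minty:
  fixes V :: "'a::real_inner \<Rightarrow> 'a"
  assumes cont: "continuous_on UNIV V" and u: "\<And>y. 0 \<le> V y \<bullet> (y - u)"
  shows "V u = 0"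
proof -
  \<comment> \<open>Minty's trick: testing with \<open>y = u - t *\<^sub>R V u\<close> and dividing
    by \<open>t > 0\<close> bounds this inner product above by 0; continuity lets \<open>t\<close>
    tend to 0.\<close>
  have lim: "((\<lambda>t::real. V (u - t *\<^sub>R V u) \<bullet> V u) \<longlongrightarrow> V (u - 0 *\<^sub>R V u) \<bullet> V u) (at_right 0)"
    by (intro tendsto_intros continuous_on_tendsto_compose[OF cont]) auto
  have "\<forall>\<^sub>F t in at_right (0::real). V (u - t *\<^sub>R V u) \<bullet> V u \<le> 0"
    using eventually_at_right_less
  proof eventually_elim
    case (elim t)
    then show ?case
      using u[of "u - t *\<^sub>R V u"] by (simp add: mult_le_0_iff)
  qed
  from tendsto_upperbound[OF lim this] have "V u \<bullet> V u \<le> 0" by simp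
  then show ?thesis by (metis inner_eq_zero_iff inner_ge_zero antisym)
qed

text \<open>For fixed \<open>y\<close>, monotonicity bounds \<open>V y \<bullet> (y - x s)\<close>
  below by a quantity tending to 0. The bound is affine in \<open>x s\<close>, so it survives the
  passage to \<open>u\<close> and becomes Minty's inequality.\<close>

lemma monotone_zero_of_cluster_point:
  fixes V :: "'a::real_inner \<Rightarrow> 'a" and x :: "real \<Rightarrow> 'a"
  assumes mono: "monotone_operator V" and cont: "continuous_on UNIV V"
    and Vx: "((\<lambda>s. V (x s)) \<longlongrightarrow> 0) at_top" and bdd: "\<forall>\<^sub>F s in at_top. norm (x s) \<le> B"
    and u: "hull_cluster_point x at_top u"
  shows "V u = 0"
proof (rule zero_of_monotone_if_Minty[OF cont])
  fix y
  have lim0: "((\<lambda>s. V (x s) \<bullet> (y - x s)) \<longlongrightarrow> 0) at_top"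
  proof (rule Lim_null_comparison)
    show "\<forall>\<^sub>F s in at_top. norm (V (x s) \<bullet> (y - x s)) \<le> norm (V (x s)) * (norm y + B)"
      using bdd
    proof eventually_elim
      case (elim s)
      have "norm (V (x s) \<bullet> (y - x s)) \<le> norm (V (x s)) * norm (y - x s)"
        using Cauchy_Schwarz_ineq2 by simp
      also have "\<dots> \<le> norm (V (x s)) * (norm y + B)"
        using elim norm_triangle_ineq4[of y "x s"] by (intro mult_left_mono) auto
      finally show ?case .
    qed
    show "((\<lambda>s. norm (V (x s)) * (norm y + B)) \<longlongrightarrow> 0) at_top"
      using tendsto_mult_right[OF tendsto_norm_zero[OF Vx], of "norm y + B"] by simp
  qed
  have "u \<bullet> V y \<le> y \<bullet> V y"
  proof (rule field_le_epsilon)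
    fix e :: real assume "e > 0"
    then have "\<forall>\<^sub>F s in at_top. - e < V (x s) \<bullet> (y - x s)"
      using order_tendstoD(1)[OF lim0] by simp
    then have "\<forall>\<^sub>F s in at_top. x s \<bullet> V y \<le> y \<bullet> V y + e"
    proof eventually_elim
      case (elim s)
      moreover have "0 \<le> (V y - V (x s)) \<bullet> (y - x s)"
        using mono by (simp add: monotone_operator_def)
      ultimately show ?case
        by (simp add: inner_diff_left inner_diff_right inner_commute)
    qed
    then show "u \<bullet> V y \<le> y \<bullet> V y + e"
      by (rule hull_cluster_point_inner_le[OF u])
  qed
  then show "0 \<le> V y \<bullet> (y - u)" by (simp add: inner_diff_right inner_commute)
qed

subsection \<open>Energy estimates\<close>

text \<open>The limit is the infimum over \<open>{a..}\<close>.\<close>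

lemma antimono_bounded_below_tendsto:
  fixes f :: "real \<Rightarrow> real"
  assumes dec: "\<And>s t. a \<le> s \<Longrightarrow> s \<le> t \<Longrightarrow> f t \<le> f s" and bdd: "\<And>t. a \<le> t \<Longrightarrow> c \<le> f t"
  obtains l where "(f \<longlongrightarrow> l) at_top"
proof
  have bdd': "bdd_below (f ` {a..})" using bdd by (intro bdd_belowI2[of _ c]) auto
  show "(f \<longlongrightarrow> (INF t\<in>{a..}. f t)) at_top"
  proof (rule order_tendstoI)
    fix y assume "y < (INF t\<in>{a..}. f t)"
    then have "y < f t" if "t \<ge> a" for t
      using cINF_lower[OF bdd', of t] that by simp
    then show "\<forall>\<^sub>F t in at_top. y < f t"
      using eventually_ge_at_top[of a] by (rule eventually_mono[rotated])
  next
    fix y assume "(INF t\<in>{a..}. f t) < y"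
    then obtain s where "s \<ge> a" "f s < y"
      using cINF_less_iff[OF _ bdd', of y] by auto
    then have "f t < y" if "t \<ge> s" for t
      using dec[of s t] that by simp
    then show "\<forall>\<^sub>F t in at_top. f t < y"
      using eventually_ge_at_top[of s] by (rule eventually_mono[rotated])
  qed
qed

lemma has_vector_derivative_imp_tendsto_quotient:
  assumes "(f has_vector_derivative f') (at s within S)"
  shows "((\<lambda>t. (f t - f s) /\<^sub>R (t - s)) \<longlongrightarrow> f') (at s within S)"
proof -
  have "((\<lambda>t. norm (f t - f s - (t - s) *\<^sub>R f') / norm (t - s)) \<longlongrightarrow> 0) (at s within S)"
    using assms unfolding has_vector_derivative_def has_derivative_iff_norm by blast
  moreover have "\<forall>\<^sub>F t in at s within S.
      norm (f t - f s - (t - s) *\<^sub>R f') / norm (t - s) = norm ((f t - f s) /\<^sub>R (t - s) - f')"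
    unfolding eventually_at_filter
  proof (intro always_eventually allI impI)
    fix t assume "t \<noteq> s"
    then have "(f t - f s) /\<^sub>R (t - s) - f' = (f t - f s - (t - s) *\<^sub>R f') /\<^sub>R (t - s)"
      by (simp add: scaleR_diff_right)
    then show "norm (f t - f s - (t - s) *\<^sub>R f') / norm (t - s) = norm ((f t - f s) /\<^sub>R (t - s) - f')"
      by (simp add: divide_inverse mult.commute)
  qed
  ultimately have "((\<lambda>t. norm ((f t - f s) /\<^sub>R (t - s) - f')) \<longlongrightarrow> 0) (at s within S)"
    by (rule Lim_transform_eventually)
  then show ?thesis
    by (metis Lim_null tendsto_norm_zero_iff)
qed

text \<open>The inner product of the two difference quotients is the monotonicity expression divided
  by \<open>(t - s)\<^sup>2\<close>. Differentiability is used along the trajectory only.\<close>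

lemma monotone_operator_derivative_inner_nonneg:
  fixes V :: "'a::real_inner \<Rightarrow> 'a"
  assumes V: "monotone_operator V"
    and x: "(x has_vector_derivative v) (at s within S)"
    and Vx: "((\<lambda>t. V (x t)) has_vector_derivative b) (at s within S)"
    and nt: "at s within S \<noteq> bot"
  shows "0 \<le> v \<bullet> b"
proof (rule tendsto_lowerbound[OF _ _ nt])
  show "((\<lambda>t. ((x t - x s) /\<^sub>R (t - s)) \<bullet> ((V (x t) - V (x s)) /\<^sub>R (t - s))) \<longlongrightarrow> v \<bullet> b) (at s within S)"
    by (intro tendsto_inner has_vector_derivative_imp_tendsto_quotient x Vx)
  have "0 \<le> ((x t - x s) /\<^sub>R (t - s)) \<bullet> ((V (x t) - V (x s)) /\<^sub>R (t - s))" for t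
  proof -
    have "0 \<le> (x t - x s) \<bullet> (V (x t) - V (x s))"
      using V by (metis monotone_operator_def inner_commute)
    then have "0 \<le> (inverse (t - s) * inverse (t - s)) * ((x t - x s) \<bullet> (V (x t) - V (x s)))"
      by (intro mult_nonneg_nonneg zero_le_square)
    then show ?thesis by (simp add: mult.assoc)
  qed
  then show "\<forall>\<^sub>F t in at s within S. 0 \<le> ((x t - x s) /\<^sub>R (t - s)) \<bullet> ((V (x t) - V (x s)) /\<^sub>R (t - s))"
    by simp
qed

text \<open>The function \<open>E \<mu>\<close> in expanded form, which displays its affine
  dependence on \<open>\<mu>\<close> and is convenient to differentiate.\<close>

definition energy :: "real \<Rightarrow> real \<Rightarrow> real \<Rightarrow> 'a::real_inner \<Rightarrow> 'a \<Rightarrow> 'a \<Rightarrow> real" where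
  "energy \<alpha> \<mu> s z v w =
    2 * \<mu> * ((\<alpha> - 1) * (z \<bullet> z) + 2 * s * (z \<bullet> v + z \<bullet> w)) + 2 * s\<^sup>2 * (v \<bullet> v + v \<bullet> w) + s\<^sup>2 * (w \<bullet> w)"

text \<open>This form shows the sign and the lower bounds; at \<open>\<mu> = 0\<close> only the two
  squares in \<open>2 v + w\<close> and \<open>w\<close> remain.\<close>

lemma energy_sum_of_squares:
  "energy \<alpha> \<mu> s z v w = (norm ((2 * \<mu>) *\<^sub>R z + s *\<^sub>R (2 *\<^sub>R v + w)))\<^sup>2 / 2
    + 2 * \<mu> * (\<alpha> - 1 - \<mu>) * (norm z)\<^sup>2 + 2 * \<mu> * s * (z \<bullet> w) + s\<^sup>2 * (norm w)\<^sup>2 / 2"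
proof -
  have comm: "v \<bullet> z = z \<bullet> v" "w \<bullet> z = z \<bullet> w" "w \<bullet> v = v \<bullet> w"
    by (simp_all add: inner_commute)
  show ?thesis
    unfolding energy_def power2_norm_eq_inner inner_add_left inner_add_right inner_scaleR_left
      inner_scaleR_right comm
    by (simp add: field_simps power2_eq_square)
qed

lemma energy_has_derivative:
  fixes z v w :: "real \<Rightarrow> 'a::real_inner"
  assumes z: "(z has_vector_derivative v s) (at s within S)"
    and v: "(v has_vector_derivative a) (at s within S)"
    and w: "(w has_vector_derivative b) (at s within S)"
    and ode: "a + (\<alpha> / s) *\<^sub>R v s + b + (\<alpha> / (2 * s)) *\<^sub>R w s = 0" and "s > 0"
  shows "((\<lambda>t. energy \<alpha> \<mu> t (z t) (v t) (w t)) has_real_derivative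
      - 2 * \<mu> * (\<alpha> - 2) * (z s \<bullet> w s)
      - s * (4 * (\<alpha> - 1 - \<mu>) * (v s \<bullet> v s + v s \<bullet> w s) + (\<alpha> - 2) * (w s \<bullet> w s))
      - 2 * s\<^sup>2 * (v s \<bullet> b)) (at s within S)"
proof -
  have inner: "((\<lambda>t. f t \<bullet> g t) has_real_derivative f s \<bullet> g' + f' \<bullet> g s) (at s within S)"
    if "(f has_vector_derivative f') (at s within S)" "(g has_vector_derivative g') (at s within S)"
    for f g :: "real \<Rightarrow> 'a" and f' g'
    using bounded_bilinear.has_vector_derivative[OF bounded_bilinear_inner that]
    by (simp add: has_real_derivative_iff_has_vector_derivative)
  \<comment> \<open>Eliminating the acceleration cancels the terms in \<open>z \<bullet> v\<close>
    and \<open>z \<bullet> b\<close>, as well as \<open>w \<bullet> b\<close>.\<close>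
  have a: "a = - (\<alpha> / s) *\<^sub>R v s - b - (\<alpha> / (2 * s)) *\<^sub>R w s"
    using ode by (simp add: algebra_simps eq_neg_iff_add_eq_0)
  have comm: "v s \<bullet> z s = z s \<bullet> v s" "w s \<bullet> z s = z s \<bullet> w s" "w s \<bullet> v s = v s \<bullet> w s" "b \<bullet> z s = z s \<bullet> b"
    "b \<bullet> v s = v s \<bullet> b" "b \<bullet> w s = w s \<bullet> b"
    by (simp_all add: inner_commute)
  show ?thesis
    unfolding energy_def
  proof (rule DERIV_cong, (rule derivative_intros inner z v w)+, goal_cases)
    case 1
    show ?case
      unfolding a inner_add_left inner_add_right inner_diff_left inner_diff_right inner_scaleR_left
        inner_scaleR_right inner_minus_left inner_minus_right comm
      using \<open>s > 0\<close> by (simp add: field_simps power2_eq_square)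
  qed
qed

lemma abs_continuous_on_interval_energy:
  assumes "abs_continuous_on_interval a b z" "abs_continuous_on_interval a b v"
    "abs_continuous_on_interval a b w"
  shows "abs_continuous_on_interval a b (\<lambda>t. energy \<alpha> \<mu> t (z t) (v t) (w t))"
  unfolding energy_def power2_eq_square
  by (intro abs_continuous_on_interval_add abs_continuous_on_interval_mult
      abs_continuous_on_interval_inner abs_continuous_on_interval_const
      abs_continuous_on_interval_ident assms)

lemma energy_affine: "energy \<alpha> \<mu> s z v w =
    energy \<alpha> 0 s z v w + 2 * \<mu> * ((\<alpha> - 1) * (norm z)\<^sup>2 + 2 * s * (z \<bullet> (v + w)))"
  by (simp add: energy_def inner_add_right power2_norm_eq_inner)

lemma energy_nonneg:
  assumes "0 \<le> \<mu>" "\<mu> \<le> \<alpha> - 1" "0 \<le> s" "0 \<le> z \<bullet> w"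
  shows "0 \<le> energy \<alpha> \<mu> s z v w"
  unfolding energy_sum_of_squares using assms by simp

text \<open>Twice the energy at \<open>\<mu> = 0\<close> is the sum of the squares of
  \<open>s * norm (2 *\<^sub>R v + w)\<close> and \<open>s * norm w\<close>; \<open>v\<close> is
  recovered from \<open>2 v = (2 v + w) - w\<close>.\<close>

lemma norm_le_sqrt_energy_0:
  assumes "0 \<le> s"
  shows "s * norm w \<le> sqrt (2 * energy \<alpha> 0 s z v w)" "s * norm v \<le> sqrt (2 * energy \<alpha> 0 s z v w)"
proof -
  let ?u = "2 *\<^sub>R v + w"
  have E: "2 * energy \<alpha> 0 s z v w = (s * norm ?u)\<^sup>2 + (s * norm w)\<^sup>2"
    unfolding energy_sum_of_squares by (simp add: power_mult_distrib)
  show w: "s * norm w \<le> sqrt (2 * energy \<alpha> 0 s z v w)"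
    unfolding E by (rule real_le_rsqrt) simp
  have u: "s * norm ?u \<le> sqrt (2 * energy \<alpha> 0 s z v w)"
    unfolding E by (rule real_le_rsqrt) simp
  have "2 * norm v \<le> norm ?u + norm w"
    using norm_triangle_ineq4[of ?u w] by simp
  from mult_left_mono[OF this assms] have "2 * (s * norm v) \<le> s * norm ?u + s * norm w"
    by (simp add: algebra_simps)
  with u w show "s * norm v \<le> sqrt (2 * energy \<alpha> 0 s z v w)" by argo
qed

section \<open>Energy decay and limits along a solution\<close>

lemma at_within_Ici_neq_bot: "(s0::real) \<le> s \<Longrightarrow> at s within {s0..} \<noteq> bot"
  using at_le[of "{s<..}" "{s0..}" s] trivial_limit_at_right_real[of s]
  by (auto simp: bot_unique subset_eq)

text \<open>Of the three groups in the derivative of the energy, the first and the last are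
  nonpositive by monotonicity of \<open>V\<close>; the middle one is left to the lower bound
  \<open>m\<close>, to be chosen for each \<open>\<mu>\<close>.\<close>

lemma is_solution_energy_decay:
  fixes V :: "'a::real_inner \<Rightarrow> 'a"
  assumes mono: "monotone_operator V" and "V z0 = 0" and "\<alpha> > 2" and "s0 > 0"
    and sol: "is_solution V \<alpha> s0 x0 x1 x" and \<mu>: "1 \<le> \<mu>" "\<mu> \<le> \<alpha> - 1"
    and ab: "s0 \<le> a" "a \<le> b"
    and m: "\<And>t. t \<in> {a..b} \<Longrightarrow>
      t * (4 * (\<alpha> - 1 - \<mu>) * (velocity s0 x t \<bullet> velocity s0 x t + velocity s0 x t \<bullet> V (x t))
        + (\<alpha> - 2) * (V (x t) \<bullet> V (x t))) \<ge> m"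
  defines "E \<equiv> \<lambda>t. energy \<alpha> \<mu> t (x t - z0) (velocity s0 x t) (V (x t))"
  shows "E b - E a \<le> - m * (b - a)"
proof -
  let ?v = "velocity s0 x"
  have "AE s in lebesgue. s \<ge> s0 \<longrightarrow>
      (\<exists>a b. (?v has_vector_derivative a) (at s within {s0..}) \<and>
             ((\<lambda>t. V (x t)) has_vector_derivative b) (at s within {s0..}) \<and>
             a + (\<alpha> / s) *\<^sub>R ?v s + b + (\<alpha> / (2 * s)) *\<^sub>R V (x s) = 0)"
    using sol by (simp add: is_solution_def)
  then obtain N where "N \<in> null_sets lebesgue" and N: "\<And>s. s \<notin> N \<Longrightarrow> s \<ge> s0 \<Longrightarrow>
      (\<exists>a b. (?v has_vector_derivative a) (at s within {s0..}) \<and>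
             ((\<lambda>t. V (x t)) has_vector_derivative b) (at s within {s0..}) \<and>
             a + (\<alpha> / s) *\<^sub>R ?v s + b + (\<alpha> / (2 * s)) *\<^sub>R V (x s) = 0)"
    by (elim AE_E3) auto
  have ac: "abs_continuous_on_interval a b x" "abs_continuous_on_interval a b ?v"
    "abs_continuous_on_interval a b (\<lambda>t. V (x t))"
    using sol ab by (auto simp: is_solution_def intro: abs_continuous_on_interval_subset[of s0 b])
  show ?thesis
  proof (rule abs_continuous_mean_value_le[OF \<open>a \<le> b\<close>])
    show "abs_continuous_on_interval a b E"
      unfolding E_def
      by (intro abs_continuous_on_interval_energy abs_continuous_on_interval_diff
          abs_continuous_on_interval_const ac)
    show "negligible N"
      using \<open>N \<in> null_sets lebesgue\<close> by (simp add: negligible_iff_null_sets)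
    fix t assume t: "t \<in> {a..b} - N"
    then have "s0 \<le> t" "t > 0" using ab \<open>s0 > 0\<close> by auto
    have x: "(x has_vector_derivative ?v t) (at t within {s0..})"
      using sol \<open>s0 \<le> t\<close> by (simp add: is_solution_def velocity_def vector_derivative_works)
    obtain a' b' where v: "(?v has_vector_derivative a') (at t within {s0..})"
      and w: "((\<lambda>t. V (x t)) has_vector_derivative b') (at t within {s0..})"
      and ode: "a' + (\<alpha> / t) *\<^sub>R ?v t + b' + (\<alpha> / (2 * t)) *\<^sub>R V (x t) = 0"
      using N[of t] t \<open>s0 \<le> t\<close> by auto
    have z: "((\<lambda>t. x t - z0) has_vector_derivative ?v t) (at t within {s0..})"
      using has_vector_derivative_diff[OF x has_vector_derivative_const[of z0]] by simp
    define D where "D = - 2 * \<mu> * (\<alpha> - 2) * ((x t - z0) \<bullet> V (x t))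
      - t * (4 * (\<alpha> - 1 - \<mu>) * (?v t \<bullet> ?v t + ?v t \<bullet> V (x t)) + (\<alpha> - 2) * (V (x t) \<bullet> V (x t)))
      - 2 * t\<^sup>2 * (?v t \<bullet> b')"
    have "(E has_real_derivative D) (at t within {s0..})"
      unfolding E_def D_def by (rule energy_has_derivative[OF z v w ode \<open>t > 0\<close>])
    then have "(E has_real_derivative D) (at t within {a..b})"
      by (rule DERIV_subset) (use ab in auto)
    moreover have "D \<le> - m"
    proof -
      have "0 \<le> (x t - z0) \<bullet> V (x t)"
        using mono \<open>V z0 = 0\<close> by (metis monotone_operator_def inner_commute diff_zero)
      then have "0 \<le> 2 * \<mu> * (\<alpha> - 2) * ((x t - z0) \<bullet> V (x t))"
        using \<mu> \<open>\<alpha> > 2\<close> by simp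
      moreover have "0 \<le> 2 * t\<^sup>2 * (?v t \<bullet> b')"
        using monotone_operator_derivative_inner_nonneg[OF mono x w at_within_Ici_neq_bot[OF \<open>s0 \<le> t\<close>]]
        by simp
      ultimately show ?thesis using m[of t] t unfolding D_def by simp
    qed
    ultimately show "\<exists>D\<le>- m. (E has_real_derivative D) (at t within {a..b})" by blast
  qed
qed

text \<open>The zero \<open>z0\<close> is arbitrary because Opial's argument needs convergent
  distances to every zero, and the energy depends on the zero chosen.\<close>

lemma is_solution_limits:
  fixes V :: "'a::real_inner \<Rightarrow> 'a"
  assumes mono: "monotone_operator V" and z0: "V z0 = 0" and "\<alpha> > 2" and "s0 > 0"
    and sol: "is_solution V \<alpha> s0 x0 x1 x"
  shows "((\<lambda>s. s * norm (V (x s))) \<longlongrightarrow> 0) at_top"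
    and "((\<lambda>s. s * norm (velocity s0 x s)) \<longlongrightarrow> 0) at_top"
    and "\<exists>l. ((\<lambda>s. norm (x s - z0)) \<longlongrightarrow> l) at_top"
proof -
  let ?v = "velocity s0 x"
  define E where "E \<mu> t = energy \<alpha> \<mu> t (x t - z0) (?v t) (V (x t))" for \<mu> t
  note decay = is_solution_energy_decay[OF assms, folded E_def]
  have pairing: "0 \<le> (x t - z0) \<bullet> V (x t)" for t
    using mono z0 by (metis monotone_operator_def inner_commute diff_zero)
  have E_nonneg: "0 \<le> E \<mu> t" if "0 \<le> \<mu>" "\<mu> \<le> \<alpha> - 1" "s0 \<le> t" for \<mu> t
    unfolding E_def using that \<open>s0 > 0\<close> pairing by (intro energy_nonneg) auto
  \<comment> \<open>At \<open>\<mu> = 1\<close> the middle group of the derivative is a multiple of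
    the square of \<open>2 v + w\<close>.\<close>
  have decay1: "E 1 t \<le> E 1 s" if "s0 \<le> s" "s \<le> t" for s t
  proof -
    have "E 1 t - E 1 s \<le> - 0 * (t - s)"
    proof (rule decay)
      fix r assume r: "r \<in> {s..t}"
      have "4 * (\<alpha> - 1 - 1) * (?v r \<bullet> ?v r + ?v r \<bullet> V (x r)) + (\<alpha> - 2) * (V (x r) \<bullet> V (x r)) =
          (\<alpha> - 2) * (norm (2 *\<^sub>R ?v r + V (x r)))\<^sup>2"
        unfolding power2_norm_eq_inner inner_add_left inner_add_right inner_scaleR_left inner_scaleR_right
          inner_commute[of "V (x r)" "?v r"] by (simp add: algebra_simps)
      also have "\<dots> \<ge> 0" using \<open>\<alpha> > 2\<close> by simp
      finally show "0 \<le> r * (4 * (\<alpha> - 1 - 1) * (?v r \<bullet> ?v r + ?v r \<bullet> V (x r)) + (\<alpha> - 2) * (V (x r) \<bullet> V (x r)))"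
        using r that \<open>s0 > 0\<close> by simp
    qed (use that \<open>\<alpha> > 2\<close> in auto)
    then show ?thesis by simp
  qed
  \<comment> \<open>At \<open>\<mu> = \<alpha> / 2\<close> the middle group is exactly
    \<open>(\<alpha> - 2) * E 0 r / r\<close>.\<close>
  have decay2: "E (\<alpha> / 2) t - E (\<alpha> / 2) s \<le> - m * (t - s)"
    if "s0 \<le> s" "s \<le> t" "\<And>r. r \<in> {s..t} \<Longrightarrow> m \<le> (\<alpha> - 2) * E 0 r / r" for s t m
  proof (rule decay)
    fix r assume r: "r \<in> {s..t}"
    then have "r > 0" using that \<open>s0 > 0\<close> by auto
    have "r * (4 * (\<alpha> - 1 - \<alpha> / 2) * (?v r \<bullet> ?v r + ?v r \<bullet> V (x r)) + (\<alpha> - 2) * (V (x r) \<bullet> V (x r))) =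
        (\<alpha> - 2) * E 0 r / r"
      using \<open>r > 0\<close> unfolding E_def energy_def by (simp add: field_simps power2_eq_square)
    with that(3)[OF r] show "m \<le> r * (4 * (\<alpha> - 1 - \<alpha> / 2) * (?v r \<bullet> ?v r + ?v r \<bullet> V (x r)) + (\<alpha> - 2) * (V (x r) \<bullet> V (x r)))"
      by simp
  qed (use that \<open>\<alpha> > 2\<close> in auto)
  have decay2': "E (\<alpha> / 2) t \<le> E (\<alpha> / 2) s" if "s0 \<le> s" "s \<le> t" for s t
    using decay2[OF that, of 0] that \<open>\<alpha> > 2\<close> \<open>s0 > 0\<close> E_nonneg[of 0] by simp
  obtain l1 where l1: "(E 1 \<longlongrightarrow> l1) at_top"
    using antimono_bounded_below_tendsto[of s0 "E 1" 0] decay1 E_nonneg[of 1] \<open>\<alpha> > 2\<close> by auto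
  obtain l2 where l2: "(E (\<alpha> / 2) \<longlongrightarrow> l2) at_top"
    using antimono_bounded_below_tendsto[of s0 "E (\<alpha> / 2)" 0] decay2' E_nonneg[of "\<alpha> / 2"] \<open>\<alpha> > 2\<close> by auto
  \<comment> \<open>Half the slope of the energy in \<open>\<mu>\<close>; its limit follows from
    those at the two distinct values 1 and \<open>\<alpha> / 2\<close>.\<close>
  define P where "P t = (\<alpha> - 1) * (norm (x t - z0))\<^sup>2 + 2 * t * ((x t - z0) \<bullet> (?v t + V (x t)))" for t
  have affine: "E \<mu> t = E 0 t + 2 * \<mu> * P t" for \<mu> t
    unfolding E_def P_def by (rule energy_affine)
  have P_eq: "P t = (E (\<alpha> / 2) t - E 1 t) / (\<alpha> - 2)" for t
    using affine[of "\<alpha> / 2" t] affine[of 1 t] \<open>\<alpha> > 2\<close> by (simp add: field_simps)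
  define p where "p = (l2 - l1) / (\<alpha> - 2)"
  have P: "(P \<longlongrightarrow> p) at_top"
    unfolding P_eq p_def by (intro tendsto_intros l1 l2) (use \<open>\<alpha> > 2\<close> in auto)
  define q where "q = l1 - 2 * p"
  have E_0: "E 0 = (\<lambda>t. E 1 t - 2 * P t)" using affine[of 1] by simp
  have q: "(E 0 \<longlongrightarrow> q) at_top"
    unfolding q_def E_0 by (intro tendsto_intros l1 P)
  have ge_s0: "\<forall>\<^sub>F t in at_top. s0 \<le> t" by (rule eventually_ge_at_top)
  have "q = 0"
  proof (rule ccontr)
    assume "q \<noteq> 0"
    have "\<forall>\<^sub>F t in at_top. 0 \<le> E 0 t"
      using ge_s0 by (rule eventually_mono) (use E_nonneg[of 0] \<open>\<alpha> > 2\<close> in auto)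
    then have "0 \<le> q"
      by (rule tendsto_lowerbound[OF q]) simp
    with \<open>q \<noteq> 0\<close> have "q > 0" by simp
    then obtain T where T: "\<And>t. t \<ge> T \<Longrightarrow> E 0 t > q / 2"
      using order_tendstoD(1)[OF q, of "q / 2"] by (auto simp: eventually_at_top_linorder)
    \<comment> \<open>On \<open>{t..2 * t}\<close> the decay rate is at least
      \<open>(\<alpha> - 2) * (q / 2) / (2 * t)\<close>, so the loss over this length
      \<open>t\<close> is at least \<open>?k\<close>, independently of \<open>t\<close>. Convergence
      of \<open>?F\<close> forbids this.\<close>
    let ?F = "E (\<alpha> / 2)" and ?k = "(\<alpha> - 2) * q / 4"
    have "\<forall>\<^sub>F t in at_top. ?F (2 * t) - ?F t \<le> - ?k"
      using ge_s0 eventually_ge_at_top[of T]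
    proof eventually_elim
      case (elim t)
      have "t > 0" using elim \<open>s0 > 0\<close> by simp
      have "?F (2 * t) - ?F t \<le> - (?k / t) * (2 * t - t)"
      proof (rule decay2)
        fix r assume r: "r \<in> {t..2 * t}"
        then have "r > 0" using \<open>t > 0\<close> by simp
        have "?k / t = (\<alpha> - 2) * (q / 2) / (2 * t)" by simp
        also have "\<dots> \<le> (\<alpha> - 2) * E 0 r / r"
          using r T[of r] elim \<open>q > 0\<close> \<open>\<alpha> > 2\<close> \<open>r > 0\<close>
          by (intro frac_le mult_left_mono mult_nonneg_nonneg) auto
        finally show "?k / t \<le> (\<alpha> - 2) * E 0 r / r" .
      qed (use elim \<open>t > 0\<close> in auto)
      also have "\<dots> = - ?k" using \<open>t > 0\<close> by simp
      finally show ?case .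
    qed
    moreover have "((\<lambda>t. ?F (2 * t) - ?F t) \<longlongrightarrow> l2 - l2) at_top"
    proof (intro tendsto_diff l2 filterlim_compose[OF l2])
      show "filterlim (\<lambda>t::real. 2 * t) at_top at_top"
        by (rule filterlim_tendsto_pos_mult_at_top[OF tendsto_const _ filterlim_ident]) simp
    qed
    ultimately have "l2 - l2 \<le> - ?k"
      by (intro tendsto_upperbound) auto
    then show False using \<open>q > 0\<close> \<open>\<alpha> > 2\<close> by (simp add: mult_le_0_iff)
  qed
  then have sqrt0: "((\<lambda>t. sqrt (2 * E 0 t)) \<longlongrightarrow> 0) at_top"
    using tendsto_real_sqrt[OF tendsto_mult[OF tendsto_const[of 2] q]] by simp
  show w: "((\<lambda>s. s * norm (V (x s))) \<longlongrightarrow> 0) at_top"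
  proof (rule Lim_null_comparison[OF _ sqrt0])
    show "\<forall>\<^sub>F t in at_top. norm (t * norm (V (x t))) \<le> sqrt (2 * E 0 t)"
      using ge_s0
    proof eventually_elim
      case (elim t)
      then show ?case
        using norm_le_sqrt_energy_0(1)[of t "V (x t)" \<alpha> "x t - z0" "?v t"] \<open>s0 > 0\<close>
        by (simp add: E_def)
    qed
  qed
  show v: "((\<lambda>s. s * norm (?v s)) \<longlongrightarrow> 0) at_top"
  proof (rule Lim_null_comparison[OF _ sqrt0])
    show "\<forall>\<^sub>F t in at_top. norm (t * norm (?v t)) \<le> sqrt (2 * E 0 t)"
      using ge_s0
    proof eventually_elim
      case (elim t)
      then show ?case
        using norm_le_sqrt_energy_0(2)[of t "?v t" \<alpha> "x t - z0" "V (x t)"] \<open>s0 > 0\<close>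
        by (simp add: E_def)
    qed
  qed
  \<comment> \<open>The coefficient \<open>2 * \<mu> * (\<alpha> - 1 - \<mu>)\<close> of the squared
    distance equals \<open>\<alpha> * (\<alpha> / 2 - 1)\<close> at
    \<open>\<mu> = \<alpha> / 2\<close>, which is positive.\<close>
  define B where "B = sqrt (E (\<alpha> / 2) s0 / (\<alpha> * (\<alpha> / 2 - 1)))"
  have B: "norm (x t - z0) \<le> B" if "s0 \<le> t" for t
  proof -
    have "\<alpha> * (\<alpha> / 2 - 1) > 0" using \<open>\<alpha> > 2\<close> by simp
    have "2 * (\<alpha> / 2) * (\<alpha> - 1 - \<alpha> / 2) * (norm (x t - z0))\<^sup>2 \<le> E (\<alpha> / 2) t"
      using pairing[of t] that \<open>s0 > 0\<close> \<open>\<alpha> > 2\<close> unfolding E_def energy_sum_of_squares by simp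
    also have "\<dots> \<le> E (\<alpha> / 2) s0"
      using that by (intro decay2') auto
    finally have "\<alpha> * (\<alpha> / 2 - 1) * (norm (x t - z0))\<^sup>2 \<le> E (\<alpha> / 2) s0"
      by (simp add: algebra_simps)
    then have "(norm (x t - z0))\<^sup>2 \<le> E (\<alpha> / 2) s0 / (\<alpha> * (\<alpha> / 2 - 1))"
      using \<open>\<alpha> * (\<alpha> / 2 - 1) > 0\<close> by (simp add: pos_le_divide_eq mult.commute)
    then show ?thesis unfolding B_def by (rule real_le_rsqrt)
  qed
  have cross: "((\<lambda>t. t * ((x t - z0) \<bullet> (?v t + V (x t)))) \<longlongrightarrow> 0) at_top"
  proof (rule Lim_null_comparison)
    show "\<forall>\<^sub>F t in at_top. norm (t * ((x t - z0) \<bullet> (?v t + V (x t)))) \<le>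
        B * (t * norm (?v t) + t * norm (V (x t)))"
      using ge_s0
    proof eventually_elim
      case (elim t)
      then have "t > 0" using \<open>s0 > 0\<close> by simp
      have "\<bar>(x t - z0) \<bullet> (?v t + V (x t))\<bar> \<le> norm (x t - z0) * norm (?v t + V (x t))"
        by (rule Cauchy_Schwarz_ineq2)
      also have "\<dots> \<le> B * (norm (?v t) + norm (V (x t)))"
        using B[OF elim] order_trans[OF norm_ge_zero B[OF elim]]
        by (intro mult_mono norm_triangle_ineq) auto
      finally have "\<bar>(x t - z0) \<bullet> (?v t + V (x t))\<bar> \<le> B * (norm (?v t) + norm (V (x t)))" .
      from mult_left_mono[OF this, of t] show ?case
        using \<open>t > 0\<close> by (simp add: abs_mult distrib_left mult.left_commute)
    qed
    show "((\<lambda>t. B * (t * norm (?v t) + t * norm (V (x t)))) \<longlongrightarrow> 0) at_top"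
      using tendsto_mult[OF tendsto_const[of B] tendsto_add[OF v w]] by simp
  qed
  \<comment> \<open>The definition of \<open>P\<close> solved for the distance; the cross term has
    just been shown to vanish in the limit.\<close>
  have norm_eq: "(\<lambda>t. norm (x t - z0)) =
      (\<lambda>t. sqrt ((P t - 2 * (t * ((x t - z0) \<bullet> (?v t + V (x t))))) / (\<alpha> - 1)))"
    using \<open>\<alpha> > 2\<close> by (simp add: P_def)
  have "((\<lambda>t. norm (x t - z0)) \<longlongrightarrow> sqrt ((p - 2 * 0) / (\<alpha> - 1))) at_top"
    unfolding norm_eq by (intro tendsto_intros P cross) (use \<open>\<alpha> > 2\<close> in auto)
  then show "\<exists>l. ((\<lambda>s. norm (x s - z0)) \<longlongrightarrow> l) at_top" by blast
qed

theorem theorem5p2: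
  fixes V :: "'a::{real_inner, complete_space} \<Rightarrow> 'a"
    and xstar x0 x1 :: 'a
    and \<alpha> s0 :: real
    and x :: "real \<Rightarrow> 'a"
  assumes "monotone_operator V"
    and "continuous_on UNIV V"
    and "V xstar = 0"
    and "\<alpha> > 2"
    and "s0 > 0"
    and "is_solution V \<alpha> s0 x0 x1 x"
  shows "(\<lambda>s. norm (V (x s))) \<in> o[at_top](\<lambda>s. 1 / s)
    \<and> (\<lambda>s. (x s - xstar) \<bullet> V (x s)) \<in> o[at_top](\<lambda>s. 1 / s)
    \<and> (\<lambda>s. norm (velocity s0 x s)) \<in> o[at_top](\<lambda>s. 1 / s)
    \<and> (\<exists>z. V z = 0 \<and> converges_weakly x z at_top)"
proof (intro conjI)
  \<comment> \<open>The zero is left open: \<open>xstar\<close> is inserted for the rates, every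
    zero of \<open>V\<close> for Opial's argument.\<close>
  note limits = is_solution_limits[OF assms(1) _ assms(4-6)]
  have smallo: "f \<in> o[at_top](\<lambda>s. 1 / s)" if "((\<lambda>s. s * f s) \<longlongrightarrow> 0) at_top" for f :: "real \<Rightarrow> real"
    using that eventually_gt_at_top[of "0::real"]
    by (intro smalloI_tendsto) (auto simp: mult.commute elim: eventually_mono)
  have w: "((\<lambda>s. s * norm (V (x s))) \<longlongrightarrow> 0) at_top"
    by (rule limits(1)[OF assms(3)])
  obtain l where l: "((\<lambda>s. norm (x s - xstar)) \<longlongrightarrow> l) at_top"
    using limits(3)[OF assms(3)] by blast
  show "(\<lambda>s. norm (V (x s))) \<in> o[at_top](\<lambda>s. 1 / s)"
    by (rule smallo[OF w])
  show "(\<lambda>s. norm (velocity s0 x s)) \<in> o[at_top](\<lambda>s. 1 / s)"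
    by (rule smallo[OF limits(2)[OF assms(3)]])
  show "(\<lambda>s. (x s - xstar) \<bullet> V (x s)) \<in> o[at_top](\<lambda>s. 1 / s)"
  proof (rule smallo, rule Lim_null_comparison)
    \<comment> \<open>The distance to \<open>xstar\<close> has a finite limit, so Cauchy-Schwarz
      transfers the rate of \<open>V (x s)\<close> to the pairing.\<close>
    show "((\<lambda>s. norm (x s - xstar) * (s * norm (V (x s)))) \<longlongrightarrow> 0) at_top"
      using tendsto_mult[OF l w] by simp
    show "\<forall>\<^sub>F s in at_top. norm (s * ((x s - xstar) \<bullet> V (x s))) \<le> norm (x s - xstar) * (s * norm (V (x s)))"
      using eventually_gt_at_top[of "0::real"]
    proof eventually_elim
      case (elim s)
      then show ?case
        using mult_left_mono[OF Cauchy_Schwarz_ineq2[of "x s - xstar" "V (x s)"], of s]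
        by (simp add: abs_mult mult_ac)
    qed
  qed
  have "((\<lambda>s. norm (V (x s))) \<longlongrightarrow> 0) at_top"
  proof (rule Lim_null_comparison[OF _ w])
    show "\<forall>\<^sub>F s in at_top. norm (norm (V (x s))) \<le> s * norm (V (x s))"
      using eventually_ge_at_top[of "1::real"]
      by eventually_elim (simp add: mult_le_cancel_right1)
  qed
  then have Vx: "((\<lambda>s. V (x s)) \<longlongrightarrow> 0) at_top"
    by (rule tendsto_norm_zero_cancel)
  have "\<forall>\<^sub>F s in at_top. norm (x s) \<le> l + 1 + norm xstar"
    using order_tendstoD(2)[OF l, of "l + 1", simplified]
  proof eventually_elim
    case (elim s)
    then show ?case using norm_triangle_ineq[of "x s - xstar" xstar] by simp
  qed
  note zero = monotone_zero_of_cluster_point[OF assms(1,2) Vx this]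
  have "\<exists>z\<in>{z. V z = 0}. converges_weakly x z at_top"
  proof (rule opial)
    show "{z. V z = 0} \<noteq> {}"
      using assms(3) by blast
    show "\<exists>l. ((\<lambda>s. norm (x s - z)) \<longlongrightarrow> l) at_top" if "z \<in> {z. V z = 0}" for z
      using that by (intro limits(3)) simp
    show "u \<in> {z. V z = 0}" if "hull_cluster_point x at_top u" for u
      using zero[OF that] by simp
  qed
  then show "\<exists>z. V z = 0 \<and> converges_weakly x z at_top" by auto
qed

end
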